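(* Let $K$ be a field, let $n\geq 2$, and let $R=K[x_1,\ldots,x_n]$ be the polynomial ring in $n$ variables over $K$. Then there exist infinitely many monomial ideals in $R$ that have the phenomenon of fluctuation in colon powers.
   Context: For ideals $I,J$ of a commutative ring $R$, $(J:I)=\{r\in R \mid rI\subseteq J\}$, and $I^0=R$. A monomial ideal of $K[x_1,\ldots,x_n]$ is an ideal generated by monomials. A monomial ideal $I\subset R=K[x_1,\ldots,x_n]$ has the phenomenon of fluctuation in colon powers if there exist positive integers $a<b<c$ such that at least one of the following cases occurs: (i) $(I^{a}:I)=I^{a-1}$, $(I^{b}:I)\neq I^{b-1}$, and $(I^{c}:I)=I^{c-1}$; (ii) $(I^{a}:I)\neq I^{a-1}$, $(I^{b}:I)=I^{b-1}$, and $(I^{c}:I)\neq I^{c-1}$. *)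

theory Defs
  imports
    "HOL-Library.Cardinality"
    "HOL-Library.Poly_Mapping"
    "HOL-Algebra.Ideal_Product"
    "HOL-Algebra.Algebraic_Closure_Type"
begin

text \<open>
  The ring \<open>K[x\<^sub>1, \<dots>, x\<^sub>n]\<close> is the type of finitely supported functions from exponent vectors
  \<open>'n \<Rightarrow>\<^sub>0 nat\<close> to \<open>'k\<close>, whose multiplication in \<^theory>\<open>HOL-Library.Poly_Mapping\<close> is convolution.
  The variables are indexed by the finite type \<open>'n\<close>, so \<open>n = CARD('n)\<close>.
\<close>

type_synonym ('n, 'k) mpoly = "('n \<Rightarrow>\<^sub>0 nat) \<Rightarrow>\<^sub>0 'k"

text \<open>The same ring as a record, to make the ideal theory of HOL-Algebra available.\<close>

definition mpoly_ring :: "('n::finite, 'k::field) mpoly ring" where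
  "mpoly_ring = ring_of_type_algebra"

definition monomial :: "('n \<Rightarrow>\<^sub>0 nat) \<Rightarrow> ('n::finite, 'k::field) mpoly" where
  "monomial m = Poly_Mapping.single m 1"

definition monomial_ideal :: "('n::finite, 'k::field) mpoly set \<Rightarrow> bool" where
  "monomial_ideal I \<longleftrightarrow> (\<exists>M. I = genideal mpoly_ring (monomial ` M))"

definition colon :: "('a, 'b) ring_scheme \<Rightarrow> 'a set \<Rightarrow> 'a set \<Rightarrow> 'a set" where
  "colon R J I = {r \<in> carrier R. \<forall>i\<in>I. r \<otimes>\<^bsub>R\<^esub> i \<in> J}"

text \<open>
  In \<^const>\<open>ideals_set\<close> the product is the product of ideals and the unit is the whole ring,
  hence \<open>ideal_pow R I 0 = carrier R\<close>.
\<close>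

definition ideal_pow :: "('a, 'b) ring_scheme \<Rightarrow> 'a set \<Rightarrow> nat \<Rightarrow> 'a set" where
  "ideal_pow R I k = I [^]\<^bsub>ideals_set R\<^esub> k"

definition colon_power_fluctuation :: "('a, 'b) ring_scheme \<Rightarrow> 'a set \<Rightarrow> bool" where
  "colon_power_fluctuation R I \<longleftrightarrow>
    (\<exists>a b c::nat. 0 < a \<and> a < b \<and> b < c \<and>
      ((colon R (ideal_pow R I a) I = ideal_pow R I (a - 1) \<and>
        colon R (ideal_pow R I b) I \<noteq> ideal_pow R I (b - 1) \<and>
        colon R (ideal_pow R I c) I = ideal_pow R I (c - 1)) \<or>
       (colon R (ideal_pow R I a) I \<noteq> ideal_pow R I (a - 1) \<and>
        colon R (ideal_pow R I b) I = ideal_pow R I (b - 1) \<and>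
        colon R (ideal_pow R I c) I \<noteq> ideal_pow R I (c - 1))))"

end

theory Submission
  imports Defs "HOL-Library.Set_Algebras"
begin

text \<open>
  Fix two variables \<open>x \<noteq> y\<close> and \<open>d \<ge> 4\<close>. Let \<open>\<mm> = (x, y)\<close> and let \<open>I\<close> be
  \<open>\<mm>\<^sup>d\<close> without the monomials of bidegree \<open>(2, d - 2)\<close> in \<open>(x, y)\<close>; it is generated by the
  \<open>x\<^sup>i y\<^sup>d\<^sup>-\<^sup>i\<close> with \<open>i \<noteq> 2\<close>. The hole is invisible in the powers of \<open>I\<close>: every number in
  \<open>{0..2 * d}\<close> is a sum of two elements of \<open>{0..d} - {2}\<close>, so that \<open>I\<^sup>2 = \<mm>\<^sup>2\<^sup>d\<close>, and therefore
  \<open>I\<^sup>3 = \<mm>\<^sup>3\<^sup>d\<close>. By degrees \<open>(\<mm>\<^sup>j\<^sup>+\<^sup>d : I) = \<mm>\<^sup>j\<close>. Hence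
  \<^item> \<open>(I : I)\<close> is the whole ring \<open>I\<^sup>0\<close>, as for every ideal;
  \<^item> \<open>(I\<^sup>2 : I) = \<mm>\<^sup>d \<noteq> I\<close>;
  \<^item> \<open>(I\<^sup>3 : I) = \<mm>\<^sup>2\<^sup>d = I\<^sup>2\<close>.

  So \<open>a = 1\<close>, \<open>b = 2\<close>, \<open>c = 3\<close> witness fluctuation, and different \<open>d\<close> give different ideals.

  The ideals at hand are determined by the set of exponent vectors that may occur in
  their elements. The lemmas \<open>ideal_prod_supported_on\<close> and \<open>colon_supported_on\<close> turn products and
  colons of such ideals into Minkowski sums and residuals of sets of exponent vectors, which reduces
  the theorem to arithmetic with pairs of natural numbers.
\<close>

section \<open>Monomial ideals and sets of exponent vectors\<close>

definition supported_on :: "('n::finite \<Rightarrow>\<^sub>0 nat) set \<Rightarrow> ('n, 'k::field) mpoly set" where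
  "supported_on U = {p. Poly_Mapping.keys p \<subseteq> U}"

definition up_closed :: "('a \<Rightarrow>\<^sub>0 nat) set \<Rightarrow> bool" where
  "up_closed U \<longleftrightarrow> (\<forall>u\<in>U. \<forall>v. u + v \<in> U)"

lemma up_closed_add_left: "up_closed U \<Longrightarrow> u \<in> U \<Longrightarrow> v + u \<in> U"
  by (simp add: up_closed_def add.commute[of v])

lemma UNIV_plus_up_closed:
  assumes "up_closed U"
  shows "UNIV + U = U"
proof
  show "UNIV + U \<subseteq> U" using assms by (auto simp: set_plus_def intro: up_closed_add_left)
  show "U \<subseteq> UNIV + U" by (metis UNIV_I add_0 set_plus_intro subsetI)
qed

lemma mpoly_ring_simps [simp]:
  "carrier mpoly_ring = UNIV" "p \<otimes>\<^bsub>mpoly_ring\<^esub> q = p * q" "p \<oplus>\<^bsub>mpoly_ring\<^esub> q = p + q"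
  "\<zero>\<^bsub>mpoly_ring\<^esub> = 0" "\<one>\<^bsub>mpoly_ring\<^esub> = 1"
  by (simp_all add: mpoly_ring_def ring_of_type_algebra_def)

lemma cring_mpoly_ring: "cring (mpoly_ring :: ('n::finite, 'k::field) mpoly ring)"
  unfolding mpoly_ring_def by (rule cring_from_type_algebra)

lemma single_mem_supported_on [simp]:
  "Poly_Mapping.single m c \<in> supported_on U \<longleftrightarrow> c = 0 \<or> m \<in> U"
  by (auto simp: supported_on_def)

lemma zero_mem_supported_on [simp]: "0 \<in> supported_on U"
  by (simp add: supported_on_def)

lemma add_mem_supported_on:
  assumes "p \<in> supported_on U" "q \<in> supported_on U"
  shows "p + q \<in> supported_on U"
  using assms keys_add[of p q] by (auto simp: supported_on_def)

lemma mult_mem_supported_on: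
  assumes "p \<in> supported_on U" "q \<in> supported_on V"
  shows "p * q \<in> supported_on (U + V)"
  using assms keys_mult[of p q] unfolding supported_on_def set_plus_def by blast

lemma supported_on_UNIV [simp]: "supported_on UNIV = UNIV"
  by (simp add: supported_on_def)

lemma supported_on_eq_iff [simp]:
  "(supported_on U :: ('n::finite, 'k::field) mpoly set) = supported_on V \<longleftrightarrow> U = V"
proof
  assume eq: "(supported_on U :: ('n, 'k) mpoly set) = supported_on V"
  have "m \<in> U \<longleftrightarrow> m \<in> V" for m
    using single_mem_supported_on[of m "1::'k"] eq by (metis one_neq_zero)
  then show "U = V" by blast
qed simp

text \<open>Every polynomial is the sum of its terms.\<close>

lemma supported_on_subset_if_terms:
  assumes "0 \<in> A" and add: "\<And>p q. p \<in> A \<Longrightarrow> q \<in> A \<Longrightarrow> p + q \<in> A"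
    and terms: "\<And>m c. m \<in> U \<Longrightarrow> Poly_Mapping.single m c \<in> A"
  shows "supported_on U \<subseteq> A"
proof
  fix p :: "('a, 'b) mpoly" assume "p \<in> supported_on U"
  then have "Poly_Mapping.keys p \<subseteq> U" by (simp add: supported_on_def)
  then show "p \<in> A"
  proof (induction p rule: update_induct)
    case const
    show ?case by fact
  next
    case (update f m c)
    have "Poly_Mapping.update m c f = Poly_Mapping.single m c + f"
      using update.hyps
      by (intro poly_mapping_eqI)
        (auto simp: lookup_add lookup_update lookup_single when_def in_keys_iff)
    moreover have "m \<in> U" "Poly_Mapping.keys f \<subseteq> U"
      using update.prems update.hyps by (auto simp: keys_update)
    ultimately show ?case using update.IH terms add by auto
  qed
qed

lemma ideal_supported_on:
  assumes "up_closed U"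
  shows "ideal (supported_on U) (mpoly_ring :: ('n::finite, 'k::field) mpoly ring)"
proof -
  interpret R: cring "mpoly_ring :: ('n, 'k) mpoly ring" by (rule cring_mpoly_ring)
  have mult: "r * p \<in> supported_on U" if "p \<in> supported_on U" for r p :: "('n, 'k) mpoly"
    using mult_mem_supported_on[of r UNIV p U] that by (simp add: UNIV_plus_up_closed[OF assms])
  show ?thesis
  proof (rule idealI[OF R.ring_axioms])
    have "\<ominus>\<^bsub>mpoly_ring\<^esub> p \<in> supported_on U"
      if "p \<in> supported_on U" for p :: "('n, 'k) mpoly"
    proof -
      have "\<ominus>\<^bsub>mpoly_ring\<^esub> p = - 1 * p"
        using R.minus_equality[of "- p" p] by simp
      then show ?thesis using mult[OF that, of "- 1"] by simp
    qed
    then show "subgroup (supported_on U) (add_monoid (mpoly_ring :: ('n, 'k) mpoly ring))"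
      by (intro R.add.subgroupI) (auto simp: add_mem_supported_on simp flip: a_inv_def intro: zero_mem_supported_on)
  qed (use mult in \<open>auto simp: mult.commute\<close>)
qed

lemma monomial_ideal_supported_on:
  assumes "up_closed U"
  shows "monomial_ideal (supported_on U :: ('n::finite, 'k::field) mpoly set)"
proof -
  interpret R: cring "mpoly_ring :: ('n, 'k) mpoly ring" by (rule cring_mpoly_ring)
  let ?J = "genideal mpoly_ring (monomial ` U) :: ('n, 'k) mpoly set"
  interpret J: ideal ?J "mpoly_ring :: ('n, 'k) mpoly ring"
    by (rule R.genideal_ideal) simp
  have "?J \<subseteq> supported_on U"
    by (rule R.genideal_minimal[OF ideal_supported_on[OF assms]]) (auto simp: monomial_def)
  moreover have "supported_on U \<subseteq> ?J"
  proof (rule supported_on_subset_if_terms)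
    show "0 \<in> ?J" using J.zero_closed by simp
    show "p + q \<in> ?J" if "p \<in> ?J" "q \<in> ?J" for p q
      using J.a_closed[OF that] by simp
    show "Poly_Mapping.single m c \<in> ?J" if "m \<in> U" for m c
    proof -
      have "monomial m \<in> ?J" using R.genideal_self[of "monomial ` U"] that by auto
      then have "Poly_Mapping.single 0 c * monomial m \<in> ?J"
        using J.I_l_closed[of "monomial m" "Poly_Mapping.single 0 c"] by simp
      then show ?thesis by (simp add: monomial_def mult_single)
    qed
  qed
  ultimately show ?thesis unfolding monomial_ideal_def by blast
qed

lemma ideal_prod_supported_on:
  "ideal_prod mpoly_ring (supported_on U) (supported_on V) =
    (supported_on (U + V) :: ('n::finite, 'k::field) mpoly set)"
proof
  let ?P = "ideal_prod mpoly_ring (supported_on U) (supported_on V) :: ('n, 'k) mpoly set"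
  show "?P \<subseteq> supported_on (U + V)"
  proof
    fix p assume "p \<in> ?P"
    then show "p \<in> supported_on (U + V)"
      by induction (simp_all add: mult_mem_supported_on add_mem_supported_on)
  qed
  have prod: "p * q \<in> ?P" if "p \<in> supported_on U" "q \<in> supported_on V" for p q
    using ideal_prod.prod[OF that, of mpoly_ring] by simp
  show "supported_on (U + V) \<subseteq> ?P"
  proof (rule supported_on_subset_if_terms)
    show "0 \<in> ?P" using prod[of 0 0] by simp
    show "p + q \<in> ?P" if "p \<in> ?P" "q \<in> ?P" for p q
      using ideal_prod.sum[OF that] by simp
    show "Poly_Mapping.single m c \<in> ?P" if "m \<in> U + V" for m c
    proof -
      obtain u v where "m = u + v" "u \<in> U" "v \<in> V" using \<open>m \<in> U + V\<close> by (rule set_plus_elim)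
      then show ?thesis
        using prod[of "Poly_Mapping.single u c" "Poly_Mapping.single v 1"] by (simp add: mult_single)
    qed
  qed
qed

lemma lookup_times_monomial:
  "Poly_Mapping.lookup (p * monomial v) (m + v) = Poly_Mapping.lookup p m"
proof -
  have "Poly_Mapping.lookup (monomial v * p) (v + m) = Poly_Mapping.lookup p m"
    by (simp add: lookup_mult monomial_def lookup_single when_mult)
  then show ?thesis by (simp add: mult.commute add.commute)
qed

text \<open>
  Multiplication by a single monomial shifts the support without cancellation, so testing against the
  monomials of \<open>V\<close> already confines the support of an element of the colon.
\<close>

lemma colon_supported_on:
  "colon mpoly_ring (supported_on U) (supported_on V) =
    (supported_on {m. \<forall>v\<in>V. m + v \<in> U} :: ('n::finite, 'k::field) mpoly set)"
    (is "?C = supported_on ?W")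
proof
  show "?C \<subseteq> supported_on ?W"
  proof
    fix p assume p: "p \<in> ?C"
    have "m + v \<in> U" if m: "m \<in> Poly_Mapping.keys p" and v: "v \<in> V" for m v
    proof -
      have "p * monomial v \<in> supported_on U"
        using p v by (auto simp: colon_def monomial_def)
      moreover have "m + v \<in> Poly_Mapping.keys (p * monomial v)"
        using m by (simp add: in_keys_iff lookup_times_monomial)
      ultimately show ?thesis by (auto simp: supported_on_def)
    qed
    then show "p \<in> supported_on ?W" by (auto simp: supported_on_def)
  qed
  show "supported_on ?W \<subseteq> ?C"
  proof
    fix p :: "('n, 'k) mpoly" assume p: "p \<in> supported_on ?W"
    have "p * q \<in> supported_on U" if q: "q \<in> supported_on V" for q
    proof -
      have "?W + V \<subseteq> U" by (auto simp: set_plus_def)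
      then show ?thesis
        using mult_mem_supported_on[OF p q] by (auto simp: supported_on_def)
    qed
    then show "p \<in> ?C" by (simp add: colon_def)
  qed
qed

lemma ideal_pow_0: "ideal_pow R I 0 = carrier R"
  by (simp add: ideal_pow_def nat_pow_def ideals_set_def)

lemma ideal_pow_Suc: "ideal_pow R I (Suc k) = ideal_prod R (ideal_pow R I k) I"
  by (simp add: ideal_pow_def nat_pow_def ideals_set_def)

lemma ideal_pow_1_supported_on:
  assumes "up_closed U"
  shows "ideal_pow mpoly_ring (supported_on U) 1 = (supported_on U :: ('n::finite, 'k::field) mpoly set)"
  using ideal_prod_supported_on[of UNIV U]
  by (simp add: ideal_pow_0 ideal_pow_Suc UNIV_plus_up_closed[OF assms])

section \<open>A power of (x, y) with a hole\<close>

text \<open>The exponent vectors of the ideal \<open>(x, y)\<^sup>e\<close>.\<close>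

definition pow_xy :: "'n \<Rightarrow> 'n \<Rightarrow> nat \<Rightarrow> ('n \<Rightarrow>\<^sub>0 nat) set" where
  "pow_xy x y e = {m. e \<le> Poly_Mapping.lookup m x + Poly_Mapping.lookup m y}"

definition holed_pow_xy :: "'n \<Rightarrow> 'n \<Rightarrow> nat \<Rightarrow> ('n \<Rightarrow>\<^sub>0 nat) set" where
  "holed_pow_xy x y d = pow_xy x y d -
    {m. Poly_Mapping.lookup m x = 2 \<and> Poly_Mapping.lookup m y = d - 2}"

lemma up_closed_holed_pow_xy:
  assumes "2 \<le> d"
  shows "up_closed (holed_pow_xy x y d)"
  using assms by (auto simp: up_closed_def holed_pow_xy_def pow_xy_def lookup_add)

lemma split_exponent:
  assumes "x \<noteq> y" "i \<le> Poly_Mapping.lookup m x" "j \<le> Poly_Mapping.lookup m y"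
  obtains u v :: "'n \<Rightarrow>\<^sub>0 nat" where "m = u + v"
    "Poly_Mapping.lookup u x = i" "Poly_Mapping.lookup u y = j"
    "Poly_Mapping.lookup v x = Poly_Mapping.lookup m x - i"
    "Poly_Mapping.lookup v y = Poly_Mapping.lookup m y - j"
proof
  let ?u = "Poly_Mapping.single x i + Poly_Mapping.single y j"
  show "m = ?u + (m - ?u)"
    using assms by (intro poly_mapping_eqI) (auto simp: lookup_add lookup_minus lookup_single when_def)
qed (use assms in \<open>auto simp: lookup_add lookup_minus lookup_single when_def\<close>)

text \<open>
  A monomial is split greedily, with as much \<open>x\<close> as fits into the first factor of degree \<open>d\<close>. Only if
  the \<open>x\<close>-exponent is \<open>2\<close> or \<open>d + 2\<close> can one of the two factors fall into the hole. Then the first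
  factor gives up one \<open>x\<close> in exchange for a \<open>y\<close>: the \<open>x\<close>-exponents of the factors become
  \<open>1\<close> and \<open>1\<close>, or \<open>d - 1\<close> and \<open>3\<close>. Here \<open>4 \<le> d\<close> gives \<open>d - 1 \<noteq> 2\<close>; for \<open>d = 3\<close> the monomial
  \<open>x\<^sup>5 y\<close> has no splitting.
\<close>

lemma holed_pow_xy_plus_self:
  assumes "x \<noteq> y" "4 \<le> d"
  shows "holed_pow_xy x y d + holed_pow_xy x y d = pow_xy x y (2 * d)"
proof
  show "holed_pow_xy x y d + holed_pow_xy x y d \<subseteq> pow_xy x y (2 * d)"
    by (auto simp: set_plus_def holed_pow_xy_def pow_xy_def lookup_add)
  show "pow_xy x y (2 * d) \<subseteq> holed_pow_xy x y d + holed_pow_xy x y d"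
  proof
    fix m assume "m \<in> pow_xy x y (2 * d)"
    define a b where "a = Poly_Mapping.lookup m x" and "b = Poly_Mapping.lookup m y"
    have ab: "2 * d \<le> a + b"
      using \<open>m \<in> pow_xy x y (2 * d)\<close> by (simp add: pow_xy_def a_def b_def)
    define i where "i = (if a = 2 then 1 else if a \<le> d then a else if a = d + 2 then d - 1 else d)"
    have i: "i \<le> a" "d - i \<le> b" "i \<noteq> 2" "i \<le> d" "a - i \<noteq> 2 \<or> b - (d - i) \<noteq> d - 2"
      "d \<le> (a - i) + (b - (d - i))"
      using ab assms(2) by (auto simp: i_def)
    then obtain u v where uv: "m = u + v"
      "Poly_Mapping.lookup u x = i" "Poly_Mapping.lookup u y = d - i"
      "Poly_Mapping.lookup v x = a - i" "Poly_Mapping.lookup v y = b - (d - i)"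
      using split_exponent[OF assms(1), of i m "d - i"] by (auto simp: a_def b_def)
    have "u \<in> holed_pow_xy x y d" "v \<in> holed_pow_xy x y d"
      using uv i by (auto simp: holed_pow_xy_def pow_xy_def)
    then show "m \<in> holed_pow_xy x y d + holed_pow_xy x y d" using uv(1) by blast
  qed
qed

lemma pow_xy_plus_holed_pow_xy:
  assumes "x \<noteq> y" "3 \<le> d" "d \<le> e"
  shows "pow_xy x y e + holed_pow_xy x y d = pow_xy x y (e + d)"
proof
  show "pow_xy x y e + holed_pow_xy x y d \<subseteq> pow_xy x y (e + d)"
    by (auto simp: set_plus_def holed_pow_xy_def pow_xy_def lookup_add)
  show "pow_xy x y (e + d) \<subseteq> pow_xy x y e + holed_pow_xy x y d"
  proof
    fix m assume "m \<in> pow_xy x y (e + d)"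
    define a b where "a = Poly_Mapping.lookup m x" and "b = Poly_Mapping.lookup m y"
    have ab: "e + d \<le> a + b"
      using \<open>m \<in> pow_xy x y (e + d)\<close> by (simp add: pow_xy_def a_def b_def)
    define i where "i = (if a = 2 then 1 else if a \<le> d then a else d)"
    have i: "i \<le> a" "d - i \<le> b" "i \<noteq> 2" "i \<le> d" "e \<le> (a - i) + (b - (d - i))"
      using ab assms(2,3) by (auto simp: i_def)
    then obtain u v where uv: "m = u + v"
      "Poly_Mapping.lookup u x = i" "Poly_Mapping.lookup u y = d - i"
      "Poly_Mapping.lookup v x = a - i" "Poly_Mapping.lookup v y = b - (d - i)"
      using split_exponent[OF assms(1), of i m "d - i"] by (auto simp: a_def b_def)
    have "u \<in> holed_pow_xy x y d" "v \<in> pow_xy x y e"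
      using uv i by (auto simp: holed_pow_xy_def pow_xy_def)
    then show "m \<in> pow_xy x y e + holed_pow_xy x y d"
      using uv(1) by (metis add.commute set_plus_intro)
  qed
qed

text \<open>The pure power \<open>x\<^sup>d\<close> belongs to the holed ideal and detects the degree of the other factor.\<close>

lemma residual_pow_xy:
  assumes "x \<noteq> y" "d \<noteq> 2"
  shows "{m. \<forall>v\<in>holed_pow_xy x y d. m + v \<in> pow_xy x y (e + d)} = pow_xy x y e" (is "?L = _")
proof
  have "Poly_Mapping.single x d \<in> holed_pow_xy x y d"
    using assms by (simp add: holed_pow_xy_def pow_xy_def lookup_single)
  moreover have "m \<in> pow_xy x y e" if "m + Poly_Mapping.single x d \<in> pow_xy x y (e + d)" for m
    using that assms by (simp add: pow_xy_def lookup_add lookup_single when_def)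
  ultimately show "?L \<subseteq> pow_xy x y e" by blast
  show "pow_xy x y e \<subseteq> ?L"
    by (auto simp: holed_pow_xy_def pow_xy_def lookup_add)
qed

lemma holed_pow_xy_neq_pow_xy:
  assumes "x \<noteq> y" "2 \<le> d"
  shows "holed_pow_xy x y d \<noteq> pow_xy x y d"
proof -
  have "Poly_Mapping.single x 2 + Poly_Mapping.single y (d - 2)
      \<in> pow_xy x y d - holed_pow_xy x y d"
    using assms by (simp add: holed_pow_xy_def pow_xy_def lookup_add lookup_single when_def)
  then show ?thesis by blast
qed

lemma inj_on_holed_pow_xy:
  assumes "x \<noteq> y"
  shows "inj_on (holed_pow_xy x y) {3..}"
proof -
  \<comment> \<open>The pure powers of \<open>x\<close> in the ideal recover \<open>d\<close>.\<close>
  have mem: "Poly_Mapping.single x k \<in> holed_pow_xy x y d \<longleftrightarrow> d \<le> k" if "3 \<le> d" for d k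
    using that assms by (auto simp: holed_pow_xy_def pow_xy_def lookup_single)
  show ?thesis
    by (rule inj_onI) (metis mem atLeast_iff order_refl order_antisym)
qed

section \<open>Fluctuation\<close>

lemma colon_power_fluctuation_holed_pow_xy:
  assumes "x \<noteq> y" "4 \<le> d"
  shows "colon_power_fluctuation mpoly_ring
    (supported_on (holed_pow_xy x y d) :: ('n::finite, 'k::field) mpoly set)"
proof -
  let ?R = "mpoly_ring :: ('n, 'k) mpoly ring"
  let ?U = "holed_pow_xy x y d"
  let ?I = "supported_on ?U :: ('n, 'k) mpoly set"
  have up: "up_closed ?U" using assms by (intro up_closed_holed_pow_xy) simp
  have pow1: "ideal_pow ?R ?I 1 = ?I" by (rule ideal_pow_1_supported_on[OF up])
  have pow2: "ideal_pow ?R ?I 2 = supported_on (pow_xy x y (d + d))"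
    using holed_pow_xy_plus_self[OF assms] ideal_pow_Suc[of ?R ?I 1] pow1
    by (simp add: ideal_prod_supported_on numeral_2_eq_2 mult_2)
  have pow3: "ideal_pow ?R ?I 3 = supported_on (pow_xy x y (d + d + d))"
    using pow_xy_plus_holed_pow_xy[OF assms(1), of d "d + d"] ideal_pow_Suc[of ?R ?I 2] pow2 assms(2)
    by (simp add: ideal_prod_supported_on)
  have colon: "colon ?R (supported_on (pow_xy x y (e + d))) ?I = supported_on (pow_xy x y e)" for e
    using assms by (simp add: colon_supported_on residual_pow_xy)
  have "{m. \<forall>v\<in>?U. m + v \<in> ?U} = UNIV"
    using up by (auto intro: up_closed_add_left)
  then have "colon ?R (ideal_pow ?R ?I 1) ?I = ideal_pow ?R ?I (1 - 1)"
    by (simp only: pow1 colon_supported_on) (simp add: ideal_pow_0)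
  moreover have "colon ?R (ideal_pow ?R ?I 2) ?I \<noteq> ideal_pow ?R ?I (2 - 1)"
    using holed_pow_xy_neq_pow_xy[OF assms(1), of d] assms(2) pow1 by (simp add: pow2 colon)
  moreover have "colon ?R (ideal_pow ?R ?I 3) ?I = ideal_pow ?R ?I (3 - 1)"
    by (simp add: pow2 pow3 colon)
  ultimately show ?thesis
    unfolding colon_power_fluctuation_def
    by (intro exI[of _ "1::nat"] exI[of _ "2::nat"] exI[of _ "3::nat"]) simp
qed

theorem theorem3p4:
  assumes "CARD('n) \<ge> 2"
  shows "infinite {I :: ('n::finite, 'k::field) mpoly set.
           monomial_ideal I \<and> colon_power_fluctuation mpoly_ring I}"
proof -
  obtain x y :: 'n where xy: "x \<noteq> y"
    using obtain_subset_with_card_n[OF assms] by (metis card_2_iff)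
  let ?I = "\<lambda>d. supported_on (holed_pow_xy x y d) :: ('n, 'k) mpoly set"
  have "inj_on ?I {4..}"
    using inj_on_holed_pow_xy[OF xy] by (auto simp: inj_on_def)
  then have "infinite (?I ` {4..})"
    using finite_imageD infinite_Ici by blast
  moreover have "?I ` {4..} \<subseteq> {I. monomial_ideal I \<and> colon_power_fluctuation mpoly_ring I}"
    using colon_power_fluctuation_holed_pow_xy[OF xy]
    by (auto intro!: monomial_ideal_supported_on up_closed_holed_pow_xy)
  ultimately show ?thesis using infinite_super by blast
qed

end
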